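(* None of the classes DDR, CDDR, DMR, DP is closed under the direct product: for each class $\mathcal{C}\in\{\mathrm{DDR},\mathrm{CDDR},\mathrm{DMR},\mathrm{DP}\}$ there exist finite simple connected graphs $G,H\in\mathcal{C}$ such that the direct product $G\times H$ does not belong to $\mathcal{C}$.
   Context: $\Gamma_i(u)$ is the set of vertices at distance exactly $i$ from $u$; $A_i(G)$ is the $0/1$ matrix with $(u,v)$-entry $1$ iff $d(u,v)=i$. For a finite simple graph $G$: DDR (distance degree-regular): $|\Gamma_i(u)|=|\Gamma_i(v)|$ for all vertices $u,v$ and all $i$. CDDR (commutative distance degree-regular): $|\Gamma_i(u)\cap\Gamma_j(v)|=|\Gamma_i(v)\cap\Gamma_j(u)|$ for all vertices $u,v$ and all $1\le i,j\le\operatorname{diam}(G)$. DMR (distance mean-regular): for all $0\le h,i,j\le\operatorname{diam}(G)$ the average $\frac{1}{|\Gamma_h(u)|}\sum_{v\in\Gamma_h(u)}|\Gamma_i(u)\cap\Gamma_j(v)|$ depends only on $h,i,j$ and not on $u$. DP (distance-polynomial): for every $1\le i\le\operatorname{diam}(G)$, $A_i(G)$ is a polynomial in $A_1(G)$. The direct (tensor) product $G\times H$ has vertex set $V(G)\times V(H)$, and $(g_1,h_1)\sim(g_2,h_2)$ iff $g_1\sim g_2$ and $h_1\sim h_2$. (If a product graph is disconnected, vertices in different components are at distance $\infty$ and $\operatorname{diam}$ means the largest finite distance.) *)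

theory Defs
  imports
    "HOL-Computational_Algebra.Polynomial"
    "Jordan_Normal_Form.Matrix"
    "Graph_Theory.Pair_Digraph"
    "Graph_Theory.Digraph_Component"
    "Graph_Theory.Shortest_Path"
begin

text \<open>
  Finite simple graphs are the instances of \<^locale>\<open>pair_graph\<close>: a finite vertex set together
  with a symmetric, loop-free set of ordered pairs. The distance takes values in the extended
  reals and is infinite between different components.
\<close>

definition gdist :: "'a pair_pre_digraph \<Rightarrow> 'a \<Rightarrow> 'a \<Rightarrow> ereal" where
  "gdist G u v = wf_digraph.\<mu> (with_proj G) (\<lambda>_. 1) u v"

definition sphere_at :: "'a pair_pre_digraph \<Rightarrow> nat \<Rightarrow> 'a \<Rightarrow> 'a set" where
  "sphere_at G i u = {v \<in> pverts G. gdist G u v = ereal (real i)}"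

text \<open>The largest finite distance, also for disconnected graphs.\<close>

definition diam :: "'a pair_pre_digraph \<Rightarrow> nat" where
  "diam G = Max {i. \<exists>u\<in>pverts G. sphere_at G i u \<noteq> {}}"

definition DDR :: "'a pair_pre_digraph \<Rightarrow> bool" where
  "DDR G \<longleftrightarrow> (\<forall>u\<in>pverts G. \<forall>v\<in>pverts G. \<forall>i.
     card (sphere_at G i u) = card (sphere_at G i v))"

definition CDDR :: "'a pair_pre_digraph \<Rightarrow> bool" where
  "CDDR G \<longleftrightarrow> (\<forall>u\<in>pverts G. \<forall>v\<in>pverts G. \<forall>i\<in>{1..diam G}. \<forall>j\<in>{1..diam G}.
     card (sphere_at G i u \<inter> sphere_at G j v) = card (sphere_at G i v \<inter> sphere_at G j u))"

definition mean_intersection ::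
    "'a pair_pre_digraph \<Rightarrow> nat \<Rightarrow> nat \<Rightarrow> nat \<Rightarrow> 'a \<Rightarrow> real" where
  "mean_intersection G h i j u =
     (\<Sum>v\<in>sphere_at G h u. real (card (sphere_at G i u \<inter> sphere_at G j v)))
       / real (card (sphere_at G h u))"

text \<open>
  If the sphere of radius \<open>h\<close> around \<open>u\<close> is empty, the mean is \<open>0 / 0 = 0\<close>. This has no effect on
  the following class: the case \<open>h = 0\<close>, \<open>i = j\<close> already forces all spheres of a given radius to
  have the same size, so up to the diameter none of them is empty.
\<close>

definition DMR :: "'a pair_pre_digraph \<Rightarrow> bool" where
  "DMR G \<longleftrightarrow> (\<forall>h\<in>{0..diam G}. \<forall>i\<in>{0..diam G}. \<forall>j\<in>{0..diam G}.
     \<forall>u\<in>pverts G. \<forall>v\<in>pverts G. mean_intersection G h i j u = mean_intersection G h i j v)"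

text \<open>The distance-\<open>i\<close> matrix with respect to the enumeration \<open>vs\<close> of the vertices.\<close>

definition dist_mat :: "'a pair_pre_digraph \<Rightarrow> 'a list \<Rightarrow> nat \<Rightarrow> real mat" where
  "dist_mat G vs i = mat (length vs) (length vs)
     (\<lambda>(a, b). if gdist G (vs ! a) (vs ! b) = ereal (real i) then 1 else 0)"

text \<open>The value of a real polynomial at a square matrix.\<close>

definition poly_mat :: "real poly \<Rightarrow> real mat \<Rightarrow> real mat" where
  "poly_mat p A = mat (dim_row A) (dim_row A)
     (\<lambda>ab. \<Sum>k\<le>degree p. Polynomial.coeff p k * (A ^\<^sub>m k) $$ ab)"

text \<open>The choice of the enumeration is irrelevant: another one conjugates all the distance
  matrices by the same permutation matrix.\<close>

definition DP :: "'a pair_pre_digraph \<Rightarrow> bool" where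
  "DP G \<longleftrightarrow> (\<exists>vs. distinct vs \<and> set vs = pverts G \<and>
     (\<forall>i\<in>{1..diam G}. \<exists>p. dist_mat G vs i = poly_mat p (dist_mat G vs 1)))"

definition direct_product ::
    "'a pair_pre_digraph \<Rightarrow> 'b pair_pre_digraph \<Rightarrow> ('a \<times> 'b) pair_pre_digraph" where
  "direct_product G H = \<lparr> pverts = pverts G \<times> pverts H,
     parcs = {((g1, h1), (g2, h2)) | g1 h1 g2 h2. (g1, g2) \<in> parcs G \<and> (h1, h2) \<in> parcs H} \<rparr>"

lemma pair_graph_direct_product:
  assumes "pair_graph G" "pair_graph H"
  shows "pair_graph (direct_product G H)"
proof -
  interpret G: pair_graph G by fact
  interpret H: pair_graph H by fact
  let ?P = "direct_product G H"
  have wf: "parcs ?P \<subseteq> pverts ?P \<times> pverts ?P"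
    by (auto simp: direct_product_def dest: G.in_arcsD1 G.in_arcsD2 H.in_arcsD1 H.in_arcsD2)
  have fin: "finite (pverts ?P)"
    by (simp add: direct_product_def G.pair_finite_verts H.pair_finite_verts)
  have sym: "Relation.sym (parcs ?P)"
    using G.pair_sym_arcs H.pair_sym_arcs
    by (auto simp: direct_product_def symmetric_def sym_def)
  have loopfree: "fst e \<noteq> snd e" if "e \<in> parcs ?P" for e
    using that G.pair_no_loops by (force simp: direct_product_def)
  show ?thesis
    using wf fin sym loopfree finite_subset[OF wf]
    by unfold_locales (auto simp: symmetric_def)
qed

end

theory Submission
  imports Defs "Jordan_Normal_Form.Determinant"
begin

text \<open>
  One pair of graphs refutes all four closure properties: a graph \<open>G\<close> on nine vertices and the single
  edge, whose direct product is the bipartite double cover of \<open>G\<close>.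

  The graph \<open>G\<close> is 4-regular of diameter two with two triangles at every vertex. In a regular graph of
  diameter two, the sphere of radius two is the complement of the closed neighbourhood, and its distance
  matrix is \<open>J - I - A\<close> with \<open>J\<close> the all-ones matrix. This gives DDR and CDDR at once, and DP since \<open>J\<close>
  is a polynomial in \<open>A\<close> (\<open>all_ones_poly_mat\<close>, after Hoffman). For DMR all averages reduce by linear
  relations to a single one, the number of triangles at a vertex (\<open>DMR_if_triangles_constant\<close>). The
  single edge, of diameter one, is covered by the same arguments.

  In the double cover, \<open>(v, 0)\<close> with \<open>v \<noteq> u\<close> is at distance two from \<open>(u, 0)\<close> exactly if \<open>v\<close> shares a
  neighbour with \<open>u\<close> in \<open>G\<close>. By the diameter, this excludes only those neighbours \<open>v\<close> of \<open>u\<close> for which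
  the edge \<open>u v\<close> is in no triangle. The number of triangles at \<open>u\<close> does not determine the number of such
  edges: two triangles may share an edge and cover three edges at \<open>u\<close>, or cover all four. Both happen in
  \<open>G\<close>, so spheres of radius two in the product have seven or eight elements. Each of the four properties
  forces spheres of equal radius within a component of a regular graph to have equal size: DDR by
  definition, CDDR by summation over one radius, DMR from the averages over the sphere of radius 0, and DP
  because polynomials in a matrix with constant row sums have constant row sums.
\<close>

section \<open>Polynomials in a matrix with constant row sums\<close>

lemma poly_mat_index:
  assumes A: "A \<in> carrier_mat n n" and i: "i < n" and j: "j < n" and N: "degree p \<le> N"
  shows "poly_mat p A $$ (i, j) = (\<Sum>k\<le>N. Polynomial.coeff p k * (A ^\<^sub>m k) $$ (i, j))"
proof -
  have "poly_mat p A $$ (i, j) = (\<Sum>k\<le>degree p. Polynomial.coeff p k * (A ^\<^sub>m k) $$ (i, j))"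
    using A i j by (simp add: poly_mat_def)
  also have "\<dots> = (\<Sum>k\<le>N. Polynomial.coeff p k * (A ^\<^sub>m k) $$ (i, j))"
    using N by (intro sum.mono_neutral_left) (auto simp: coeff_eq_0)
  finally show ?thesis .
qed

lemma poly_mat_index_add:
  assumes "A \<in> carrier_mat n n" "i < n" "j < n"
  shows "poly_mat (p + q) A $$ (i, j) = poly_mat p A $$ (i, j) + poly_mat q A $$ (i, j)"
  using assms
  by (simp add: poly_mat_index[of A n i j _ "max (degree p) (degree q)"] degree_add_le
      sum.distrib distrib_right)

lemma poly_mat_index_smult:
  assumes "A \<in> carrier_mat n n" "i < n" "j < n"
  shows "poly_mat (Polynomial.smult c p) A $$ (i, j) = c * poly_mat p A $$ (i, j)"
  using assms by (simp add: poly_mat_index[of A n i j _ "degree p"] degree_smult_le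
      sum_distrib_left mult.assoc)

lemma pow_mat_Suc_index:
  assumes "A \<in> carrier_mat n n" "i < n" "j < n"
  shows "(A ^\<^sub>m Suc k) $$ (i, j) = (\<Sum>l<n. (A ^\<^sub>m k) $$ (i, l) * A $$ (l, j))"
  using assms by (simp add: scalar_prod_def atLeast0LessThan)

text \<open>
  Multiplication by the indeterminate on the polynomial side is multiplication by \<open>A\<close> on the matrix side.
\<close>

lemma poly_mat_index_times_X:
  fixes A :: "real mat"
  assumes A: "A \<in> carrier_mat n n" and i: "i < n" and j: "j < n"
  shows "poly_mat (pCons 0 p) A $$ (i, j) = (\<Sum>l<n. poly_mat p A $$ (i, l) * A $$ (l, j))"
proof -
  have "poly_mat (pCons 0 p) A $$ (i, j)
      = (\<Sum>k\<le>Suc (degree p). Polynomial.coeff (pCons 0 p) k * (A ^\<^sub>m k) $$ (i, j))"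
    using A i j by (intro poly_mat_index degree_pCons_le)
  also have "\<dots> = (\<Sum>k\<le>degree p. Polynomial.coeff p k * (A ^\<^sub>m Suc k) $$ (i, j))"
    by (subst sum.atMost_Suc_shift) simp
  also have "\<dots> = (\<Sum>k\<le>degree p. \<Sum>l<n. Polynomial.coeff p k * (A ^\<^sub>m k) $$ (i, l) * A $$ (l, j))"
    by (simp only: pow_mat_Suc_index[OF A i j] sum_distrib_left mult.assoc)
  also have "\<dots> = (\<Sum>l<n. \<Sum>k\<le>degree p. Polynomial.coeff p k * (A ^\<^sub>m k) $$ (i, l) * A $$ (l, j))"
    by (rule sum.swap)
  also have "\<dots> = (\<Sum>l<n. poly_mat p A $$ (i, l) * A $$ (l, j))"
    by (intro sum.cong) (auto simp: poly_mat_index[OF A i _ order_refl] sum_distrib_right)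
  finally show ?thesis .
qed

text \<open>
  Constant row sums \<open>d\<close> mean that the all-ones vector is an eigenvector for \<open>d\<close>. It is then an
  eigenvector of every polynomial \<open>p\<close> in the matrix, for the eigenvalue \<open>poly p d\<close>.
\<close>

lemma row_sum_poly_mat:
  assumes A: "A \<in> carrier_mat n n" and rows: "\<And>i. i < n \<Longrightarrow> (\<Sum>j<n. A $$ (i, j)) = d"
    and i: "i < n"
  shows "(\<Sum>j<n. poly_mat p A $$ (i, j)) = poly p d"
proof -
  have pow: "(\<Sum>j<n. (A ^\<^sub>m k) $$ (i, j)) = d ^ k" for k
  proof (induction k)
    case 0
    then show ?case using A i by (simp add: sum.delta)
  next
    case (Suc k)
    have "(\<Sum>j<n. (A ^\<^sub>m Suc k) $$ (i, j)) = (\<Sum>j<n. \<Sum>l<n. (A ^\<^sub>m k) $$ (i, l) * A $$ (l, j))"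
      by (intro sum.cong refl pow_mat_Suc_index[OF A i]) simp
    also have "\<dots> = (\<Sum>l<n. (A ^\<^sub>m k) $$ (i, l) * (\<Sum>j<n. A $$ (l, j)))"
      by (subst sum.swap) (simp add: sum_distrib_left)
    also have "\<dots> = d ^ Suc k"
      by (simp add: rows Suc.IH flip: sum_distrib_right)
    finally show ?case .
  qed
  have "(\<Sum>j<n. poly_mat p A $$ (i, j))
      = (\<Sum>j<n. \<Sum>k\<le>degree p. Polynomial.coeff p k * (A ^\<^sub>m k) $$ (i, j))"
    by (intro sum.cong refl poly_mat_index[OF A i]) auto
  also have "\<dots> = (\<Sum>k\<le>degree p. Polynomial.coeff p k * (\<Sum>j<n. (A ^\<^sub>m k) $$ (i, j)))"
    by (subst sum.swap) (simp add: sum_distrib_left)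
  finally show ?thesis by (simp add: pow poly_altdef)
qed

text \<open>
  The \<open>n\<^sup>2 + 1\<close> matrices \<open>A\<^sup>0, \<dots>, A\<^sup>N\<close> with \<open>N = n\<^sup>2\<close> live in a space of dimension \<open>n\<^sup>2\<close>, so they
  are linearly dependent. The dependency is found as a kernel vector of the square matrix \<open>B\<close> whose
  \<open>k\<close>-th column lists the entries of \<open>A\<^sup>k\<close>, padded by a zero row, which makes \<open>B\<close> singular.
\<close>

lemma annihilating_poly_exists:
  assumes A: "A \<in> carrier_mat n n"
  shows "\<exists>p. p \<noteq> 0 \<and> (\<forall>i<n. \<forall>j<n. poly_mat p A $$ (i, j) = 0)"
proof -
  define N where "N = n * n"
  define c where "c r = vec (Suc N) (\<lambda>k. (A ^\<^sub>m k) $$ (r div n, r mod n))" for r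
  define B where "B = mat\<^sub>r (Suc N) (Suc N) (\<lambda>r. if r = N then 0\<^sub>v (Suc N) else c r)"
  have B: "B \<in> carrier_mat (Suc N) (Suc N)" by (simp add: B_def)
  have "det B = 0"
    unfolding B_def by (rule det_row_0) (auto simp: c_def)
  then obtain v where v: "v \<in> carrier_vec (Suc N)" "v \<noteq> 0\<^sub>v (Suc N)" "B *\<^sub>v v = 0\<^sub>v (Suc N)"
    using det_0_iff_vec_prod_zero[OF B] by blast
  define p where "p = Poly (list_of_vec v)"
  have coeff: "Polynomial.coeff p k = (if k \<le> N then v $ k else 0)" for k
    using v(1) by (auto simp: p_def coeff_Poly_eq nth_default_def list_of_vec_index)
  have "p \<noteq> 0"
  proof
    assume "p = 0"
    then have "v $ k = 0" if "k < Suc N" for k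
      using coeff[of k] that by simp
    then have "v = 0\<^sub>v (Suc N)"
      using v(1) by (intro eq_vecI) auto
    with v(2) show False by simp
  qed
  moreover have "poly_mat p A $$ (i, j) = 0" if i: "i < n" and j: "j < n" for i j
  proof -
    have r: "i * n + j < N"
    proof -
      have "i * n + j < Suc i * n" using j by simp
      also have "\<dots> \<le> n * n" using i by (intro mult_right_mono) auto
      finally show ?thesis by (simp add: N_def)
    qed
    have "0 = (B *\<^sub>v v) $ (i * n + j)"
      using v(3) r by simp
    also have "\<dots> = (\<Sum>k\<le>N. Polynomial.coeff p k * (A ^\<^sub>m k) $$ (i, j))"
      using r j v(1) B
      by (simp add: B_def c_def scalar_prod_def coeff atLeast0LessThan mult.commute
          flip: lessThan_Suc_atMost)
    also have "\<dots> = poly_mat p A $$ (i, j)"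
      by (rule poly_mat_index[OF A i j, symmetric]) (auto intro!: degree_le simp: coeff)
    finally show ?thesis by simp
  qed
  ultimately show ?thesis by blast
qed

text \<open>
  Hoffman's polynomial. Let \<open>m\<close> be an annihilating polynomial of least degree. Row sums show
  \<open>poly m d = 0\<close>, so \<open>m = (X - d) * q\<close>. Then \<open>q(A)\<close> is nonzero by minimality, while \<open>q(A) * A = d * q(A)\<close>
  says that its rows are left eigenvectors for \<open>d\<close>. If these are constant vectors only, then the rows
  of \<open>q(A)\<close> are constant, and since their sums all equal \<open>poly q d\<close>, the matrix \<open>q(A)\<close> is a nonzero
  multiple of the all-ones matrix.
\<close>

lemma all_ones_poly_mat:
  assumes A: "A \<in> carrier_mat n n" and "0 < n"
    and rows: "\<And>i. i < n \<Longrightarrow> (\<Sum>j<n. A $$ (i, j)) = d"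
    and simple: "\<And>x i j. \<lbrakk>\<And>k. k < n \<Longrightarrow> (\<Sum>l<n. x l * A $$ (l, k)) = d * x k; i < n; j < n\<rbrakk>
      \<Longrightarrow> x i = x j"
  shows "\<exists>p. \<forall>i<n. \<forall>j<n. poly_mat p A $$ (i, j) = 1"
proof -
  define ann where "ann p \<longleftrightarrow> p \<noteq> 0 \<and> (\<forall>i<n. \<forall>j<n. poly_mat p A $$ (i, j) = 0)" for p
  obtain m where m: "ann m" and min: "\<And>q. ann q \<Longrightarrow> degree m \<le> degree q"
    using annihilating_poly_exists[OF A] ex_has_least_nat[of ann _ degree] unfolding ann_def by metis
  have "poly m d = 0"
    using row_sum_poly_mat[OF A rows, of 0 m] m \<open>0 < n\<close> by (simp add: ann_def)
  then obtain q where q: "m = [:- d, 1:] * q"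
    by (metis poly_eq_0_iff_dvd dvdE)
  have "q \<noteq> 0" using m q by (auto simp: ann_def)
  then have "degree m = Suc (degree q)"
    unfolding q by (subst degree_mult_eq) auto
  then have "\<not> ann q"
    using min[of q] by auto
  then obtain i0 j0 where ij0: "i0 < n" "j0 < n" "poly_mat q A $$ (i0, j0) \<noteq> 0"
    using \<open>q \<noteq> 0\<close> by (auto simp: ann_def)
  define c where "c = poly q d / n"
  have entry: "poly_mat q A $$ (i, j) = c" if i: "i < n" and j: "j < n" for i j
  proof -
    have m_split: "m = pCons 0 q + Polynomial.smult (- d) q"
      by (simp add: q)
    have "(\<Sum>l<n. poly_mat q A $$ (i, l) * A $$ (l, k)) = d * poly_mat q A $$ (i, k)" if "k < n" for k
    proof -
      have "0 = poly_mat m A $$ (i, k)" using m i that by (simp add: ann_def)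
      also have "\<dots> = (\<Sum>l<n. poly_mat q A $$ (i, l) * A $$ (l, k)) - d * poly_mat q A $$ (i, k)"
        unfolding m_split
        by (simp add: poly_mat_index_add[OF A i that] poly_mat_index_smult[OF A i that]
            poly_mat_index_times_X[OF A i that] del: smult_minus_left)
      finally show ?thesis by simp
    qed
    then have "poly_mat q A $$ (i, l) = poly_mat q A $$ (i, j)" if "l < n" for l
      using simple[of "\<lambda>l. poly_mat q A $$ (i, l)"] that j by blast
    then have "(\<Sum>l<n. poly_mat q A $$ (i, l)) = n * poly_mat q A $$ (i, j)"
      by simp
    then show ?thesis
      using row_sum_poly_mat[OF A rows i, of q] \<open>0 < n\<close> by (simp add: c_def field_simps)
  qed
  then have "c \<noteq> 0" using ij0 by metis
  then have "\<forall>i<n. \<forall>j<n. poly_mat (Polynomial.smult (1 / c) q) A $$ (i, j) = 1"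
    using entry by (simp add: poly_mat_index_smult[OF A])
  then show ?thesis by blast
qed

section \<open>Spheres and walks\<close>

context pair_graph
begin

lemma parcs_sym: "(u, v) \<in> parcs G \<longleftrightarrow> (v, u) \<in> parcs G"
  using pair_sym_arcs by (auto simp: symmetric_def sym_def)

lemma relpow_parcs_sym: "(u, v) \<in> parcs G ^^ n \<longleftrightarrow> (v, u) \<in> parcs G ^^ n"
proof -
  have "(v, u) \<in> parcs G ^^ n" if "(u, v) \<in> parcs G ^^ n" for u v
    using that
  proof (induction n arbitrary: v)
    case (Suc n)
    from Suc.prems obtain w where "(u, w) \<in> parcs G ^^ n" "(w, v) \<in> parcs G"
      by auto
    with Suc.IH show ?case by (metis parcs_sym relpow_Suc_I2)
  qed auto
  then show ?thesis by blast
qed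

lemma relpow_parcs_in_verts: "u \<in> pverts G \<Longrightarrow> (u, v) \<in> parcs G ^^ n \<Longrightarrow> v \<in> pverts G"
  by (cases n) (auto dest: in_arcsD2)

lemma awalk_of_length_iff:
  "(\<exists>p. awalk u p v \<and> length p = n) \<longleftrightarrow> u \<in> pverts G \<and> (u, v) \<in> parcs G ^^ n"
proof (induction n arbitrary: u)
  case 0
  then show ?case by (auto simp: awalk_Nil_iff)
next
  case (Suc n)
  have "(\<exists>p. awalk u p v \<and> length p = Suc n) \<longleftrightarrow>
      (\<exists>w. (u, w) \<in> parcs G \<and> (\<exists>p. awalk w p v \<and> length p = n))"
  proof
    assume "\<exists>p. awalk u p v \<and> length p = Suc n"
    then obtain e p where "awalk u (e # p) v" "length p = n"
      by (auto simp: length_Suc_conv)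
    then show "\<exists>w. (u, w) \<in> parcs G \<and> (\<exists>p. awalk w p v \<and> length p = n)"
      by (intro exI[of _ "snd e"]) (auto simp: awalk_Cons_iff)
  next
    assume "\<exists>w. (u, w) \<in> parcs G \<and> (\<exists>p. awalk w p v \<and> length p = n)"
    then obtain w p where "(u, w) \<in> parcs G" "awalk w p v" "length p = n"
      by blast
    then show "\<exists>p. awalk u p v \<and> length p = Suc n"
      by (intro exI[of _ "(u, w) # p"]) (simp add: awalk_Cons_iff)
  qed
  also have "\<dots> \<longleftrightarrow> (u, v) \<in> parcs G O parcs G ^^ n"
    unfolding Suc.IH by (blast dest: in_arcsD2)
  also have "\<dots> \<longleftrightarrow> u \<in> pverts G \<and> (u, v) \<in> parcs G ^^ Suc n"
    unfolding relpow.simps(2) relpow_commute[symmetric] by (blast dest: in_arcsD1)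
  finally show ?case .
qed

text \<open>
  Relational powers of the arc set describe walks of a given length, so the distance is the least
  exponent that relates the two vertices. All later computations of spheres go through this
  description.
\<close>

lemma gdist_eq_iff:
  assumes u: "u \<in> pverts G"
  shows "gdist G u v = ereal (real n) \<longleftrightarrow>
    (u, v) \<in> parcs G ^^ n \<and> (\<forall>m<n. (u, v) \<notin> parcs G ^^ m)"
proof -
  have cost: "awalk_cost (\<lambda>_. 1) p = real (length p)" for p :: "('a \<times> 'a) list"
    by (induction p) auto
  have least: "gdist G u v = ereal (real k)"
    if k: "(u, v) \<in> parcs G ^^ k" "\<forall>m<k. (u, v) \<notin> parcs G ^^ m" for k
  proof -
    obtain p where p: "awalk u p v" "length p = k"
      using awalk_of_length_iff[of u v k] u k(1) by auto
    have "k \<le> length q" if "awalk u q v" for q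
    proof -
      have "(u, v) \<in> parcs G ^^ length q"
        using awalk_of_length_iff[of u v "length q"] that by auto
      then show ?thesis using k(2) not_le by blast
    qed
    then have "(INF q\<in>{q. awalk u q v}. ereal (awalk_cost (\<lambda>_. 1) q)) = ereal (real k)"
      using p by (intro antisym INF_greatest) (auto simp: cost intro!: INF_lower2[of p])
    then show ?thesis by (simp add: gdist_def \<mu>_def)
  qed
  show ?thesis
  proof
    assume dist: "gdist G u v = ereal (real n)"
    have "\<exists>k. (u, v) \<in> parcs G ^^ k"
    proof (rule ccontr)
      assume "\<nexists>k. (u, v) \<in> parcs G ^^ k"
      then have "{q. awalk u q v} = {}"
        using awalk_of_length_iff[of u v] by auto
      then have "gdist G u v = \<infinity>" by (simp add: gdist_def \<mu>_def top_ereal_def)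
      with dist show False by simp
    qed
    then obtain k where k: "(u, v) \<in> parcs G ^^ k" "\<forall>m<k. (u, v) \<notin> parcs G ^^ m"
      using exists_least_iff[of "\<lambda>k. (u, v) \<in> parcs G ^^ k"] by blast
    with least[OF k] dist show "(u, v) \<in> parcs G ^^ n \<and> (\<forall>m<n. (u, v) \<notin> parcs G ^^ m)"
      by simp
  next
    assume "(u, v) \<in> parcs G ^^ n \<and> (\<forall>m<n. (u, v) \<notin> parcs G ^^ m)"
    with least[of n] show "gdist G u v = ereal (real n)" by blast
  qed
qed

lemma in_sphere_iff:
  assumes "u \<in> pverts G"
  shows "v \<in> sphere_at G n u \<longleftrightarrow> (u, v) \<in> parcs G ^^ n \<and> (\<forall>m<n. (u, v) \<notin> parcs G ^^ m)"
  unfolding sphere_at_def mem_Collect_eq gdist_eq_iff[OF assms]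
  using relpow_parcs_in_verts[OF assms] by blast

lemma in_sphere_sym:
  assumes "u \<in> pverts G" "v \<in> pverts G"
  shows "v \<in> sphere_at G n u \<longleftrightarrow> u \<in> sphere_at G n v"
  using assms by (simp add: in_sphere_iff relpow_parcs_sym)

lemma sphere_subset: "sphere_at G n u \<subseteq> pverts G"
  by (auto simp: sphere_at_def)

lemma finite_sphere: "finite (sphere_at G n u)"
  using sphere_subset finite_subset pair_finite_verts by blast

lemma sphere_disjoint: "m \<noteq> n \<Longrightarrow> sphere_at G m u \<inter> sphere_at G n u = {}"
  by (auto simp: sphere_at_def)

lemma sphere_0: "u \<in> pverts G \<Longrightarrow> sphere_at G 0 u = {u}"
  by (auto simp: in_sphere_iff)

lemma sphere_1: "u \<in> pverts G \<Longrightarrow> sphere_at G 1 u = parcs G `` {u}"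
  using pair_no_loops by (force simp: in_sphere_iff)

lemma sphere_2:
  assumes "u \<in> pverts G"
  shows "sphere_at G 2 u = parcs G `` (parcs G `` {u}) - insert u (parcs G `` {u})"
  using assms by (auto simp: in_sphere_iff numeral_2_eq_2 less_Suc_eq)

lemma finite_nonempty_radii: "finite {i. \<exists>u\<in>pverts G. sphere_at G i u \<noteq> {}}"
proof -
  let ?r = "\<lambda>(u, v). THE i. gdist G u v = ereal (real i)"
  have "{i. \<exists>u\<in>pverts G. sphere_at G i u \<noteq> {}} \<subseteq> ?r ` (pverts G \<times> pverts G)"
  proof
    fix i
    assume "i \<in> {i. \<exists>u\<in>pverts G. sphere_at G i u \<noteq> {}}"
    then obtain u v where "u \<in> pverts G" "v \<in> pverts G" "gdist G u v = ereal (real i)"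
      by (auto simp: sphere_at_def)
    then show "i \<in> ?r ` (pverts G \<times> pverts G)"
      by (intro image_eqI[of _ _ "(u, v)"]) auto
  qed
  then show ?thesis
    using pair_finite_verts finite_subset by blast
qed

lemma le_diam: "u \<in> pverts G \<Longrightarrow> v \<in> sphere_at G n u \<Longrightarrow> n \<le> diam G"
  unfolding diam_def by (intro Max_ge finite_nonempty_radii) auto

lemma sphere_cover:
  assumes v: "v \<in> pverts G" and reach: "(v, w) \<in> parcs G ^^ k"
  shows "\<exists>j\<le>diam G. w \<in> sphere_at G j v"
proof -
  obtain j where "(v, w) \<in> parcs G ^^ j" "\<forall>m<j. (v, w) \<notin> parcs G ^^ m"
    using reach exists_least_iff[of "\<lambda>k. (v, w) \<in> parcs G ^^ k"] by blast
  then have "w \<in> sphere_at G j v" using v by (simp add: in_sphere_iff)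
  with le_diam[OF v] show ?thesis by blast
qed

text \<open>
  Both sides count the pairs \<open>(v, w)\<close> at mutual distance \<open>j\<close> with \<open>v\<close> and \<open>w\<close> at distance \<open>h\<close> and \<open>i\<close>
  from \<open>u\<close>.
\<close>

lemma sum_sphere_intersections_swap:
  assumes u: "u \<in> pverts G"
  shows "(\<Sum>v\<in>sphere_at G h u. card (sphere_at G i u \<inter> sphere_at G j v))
    = (\<Sum>w\<in>sphere_at G i u. card (sphere_at G h u \<inter> sphere_at G j w))"
proof -
  have card: "card (sphere_at G a u \<inter> X) = (\<Sum>w\<in>sphere_at G a u. if w \<in> X then 1 else 0)" for a X
    by (subst sum.inter_restrict[OF finite_sphere, symmetric]) simp
  have "(\<Sum>v\<in>sphere_at G h u. \<Sum>w\<in>sphere_at G i u. if w \<in> sphere_at G j v then 1 else 0 :: nat)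
      = (\<Sum>v\<in>sphere_at G h u. \<Sum>w\<in>sphere_at G i u. if v \<in> sphere_at G j w then 1 else 0)"
    using in_sphere_sym sphere_subset by (intro sum.cong refl if_cong) blast
  also have "\<dots> = (\<Sum>w\<in>sphere_at G i u. \<Sum>v\<in>sphere_at G h u. if v \<in> sphere_at G j w then 1 else 0)"
    by (rule sum.swap)
  finally show ?thesis by (simp only: card)
qed

end

section \<open>Equal sphere sizes in the four classes\<close>

context pair_graph
begin

text \<open>
  Summing the defining identity of \<^const>\<open>CDDR\<close> over all radii \<open>j\<close> around the second vertex gives the
  sizes of whole spheres, provided that the sphere of radius \<open>i\<close> lies within finite distance of both
  centres. This is why a walk from \<open>u\<close> to \<open>v\<close> is assumed: the graph itself may be disconnected.
\<close>

lemma CDDR_imp_card_sphere_eq: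
  assumes "CDDR G" and u: "u \<in> pverts G" and v: "v \<in> pverts G" and uv: "(u, v) \<in> parcs G ^^ k"
    and i: "i \<in> {1..diam G}"
  shows "card (sphere_at G i u) = card (sphere_at G i v)"
proof -
  have decomp: "card (sphere_at G i x) = (\<Sum>j\<le>diam G. card (sphere_at G i x \<inter> sphere_at G j y))"
    if x: "x \<in> pverts G" and y: "y \<in> pverts G" and yx: "(y, x) \<in> parcs G ^^ k" for x y
  proof -
    have "\<exists>j\<le>diam G. w \<in> sphere_at G j y" if "w \<in> sphere_at G i x" for w
    proof -
      have "(y, w) \<in> parcs G ^^ (k + i)"
        using yx that x unfolding relpow_add in_sphere_iff[OF x] by blast
      then show ?thesis by (rule sphere_cover[OF y])
    qed
    then have "sphere_at G i x = (\<Union>j\<in>{..diam G}. sphere_at G i x \<inter> sphere_at G j y)"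
      by blast
    also have "card \<dots> = (\<Sum>j\<le>diam G. card (sphere_at G i x \<inter> sphere_at G j y))"
      using sphere_disjoint by (intro card_UN_disjoint) (auto simp: finite_sphere)
    finally show ?thesis .
  qed
  have "card (sphere_at G i u \<inter> sphere_at G j v) = card (sphere_at G i v \<inter> sphere_at G j u)"
    if "j \<le> diam G" for j
  \<comment> \<open>The defining identity starts at radius 1. At radius 0 it only says that distance is symmetric.\<close>
  proof (cases "j = 0")
    case True
    then show ?thesis using u v in_sphere_sym[OF u v, of i] by (auto simp: sphere_0)
  next
    case False
    then show ?thesis using \<open>CDDR G\<close> u v i that by (auto simp: CDDR_def)
  qed
  moreover have vu: "(v, u) \<in> parcs G ^^ k"
    using uv by (simp add: relpow_parcs_sym[of v u])
  ultimately show ?thesis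
    unfolding decomp[OF u v vu] decomp[OF v u uv] by (intro sum.cong) auto
qed

lemma DMR_imp_card_sphere_eq:
  assumes "DMR G" and u: "u \<in> pverts G" and v: "v \<in> pverts G" and i: "i \<le> diam G"
  shows "card (sphere_at G i u) = card (sphere_at G i v)"
proof -
  have "mean_intersection G 0 i i x = card (sphere_at G i x)" if "x \<in> pverts G" for x
    using that by (simp add: mean_intersection_def sphere_0)
  moreover have "mean_intersection G 0 i i u = mean_intersection G 0 i i v"
    using assms(1)[unfolded DMR_def] u v i by (meson atLeastAtMost_iff le0)
  ultimately show ?thesis using u v by simp
qed

lemma row_sum_dist_mat:
  assumes vs: "distinct vs" "set vs = pverts G" and a: "a < length vs"
  shows "(\<Sum>b<length vs. dist_mat G vs i $$ (a, b)) = card (sphere_at G i (vs ! a))"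
proof -
  have "(\<Sum>b<length vs. dist_mat G vs i $$ (a, b))
      = (\<Sum>b<length vs. if vs ! b \<in> sphere_at G i (vs ! a) then 1 else 0)"
    using a by (intro sum.cong) (auto simp: dist_mat_def sphere_at_def vs(2)[symmetric])
  also have "\<dots> = (\<Sum>w\<in>pverts G. if w \<in> sphere_at G i (vs ! a) then 1 else 0)"
    using bij_betw_nth[OF vs(1) refl vs(2)[symmetric]] by (intro sum.reindex_bij_betw)
  also have "\<dots> = card (sphere_at G i (vs ! a))"
    using sphere_subset[of i "vs ! a"]
    by (subst sum.inter_restrict[OF pair_finite_verts, symmetric]) (simp add: Int_absorb1)
  finally show ?thesis .
qed

lemma dist_mat_1_index:
  assumes vs: "set vs = pverts G" and a: "a < length vs" and b: "b < length vs"
  shows "dist_mat G vs 1 $$ (a, b) = (if (vs ! a, vs ! b) \<in> parcs G then 1 else 0)"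
proof -
  have mem: "vs ! a \<in> pverts G" "vs ! b \<in> pverts G"
    using a b nth_mem vs by blast+
  have "gdist G (vs ! a) (vs ! b) = ereal (real 1) \<longleftrightarrow> vs ! b \<in> sphere_at G 1 (vs ! a)"
    using mem by (simp add: sphere_at_def)
  then show ?thesis
    using a b mem sphere_1[of "vs ! a"] by (simp add: dist_mat_def)
qed

lemma row_sum_dist_mat_1:
  assumes reg: "\<And>x. x \<in> pverts G \<Longrightarrow> card (parcs G `` {x}) = d"
    and vs: "distinct vs" "set vs = pverts G" and a: "a < length vs"
  shows "(\<Sum>b<length vs. dist_mat G vs 1 $$ (a, b)) = real d"
proof -
  have "vs ! a \<in> pverts G" using a nth_mem vs(2) by blast
  then show ?thesis
    by (simp only: row_sum_dist_mat[OF vs a] sphere_1 reg)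
qed

text \<open>
  In a regular graph the adjacency matrix has constant row sums, hence so has every polynomial in it;
  the row sums of a distance matrix are the sizes of the spheres.
\<close>

lemma DP_imp_card_sphere_eq:
  assumes "DP G" and reg: "\<And>x. x \<in> pverts G \<Longrightarrow> card (parcs G `` {x}) = d"
    and u: "u \<in> pverts G" and v: "v \<in> pverts G" and i: "i \<in> {1..diam G}"
  shows "card (sphere_at G i u) = card (sphere_at G i v)"
proof -
  obtain vs p where vs: "distinct vs" "set vs = pverts G"
    and p: "dist_mat G vs i = poly_mat p (dist_mat G vs 1)"
    using \<open>DP G\<close> i unfolding DP_def by blast
  have A: "dist_mat G vs 1 \<in> carrier_mat (length vs) (length vs)"
    by (simp add: dist_mat_def)
  have "real (card (sphere_at G i x)) = poly p (real d)" if x: "x \<in> pverts G" for x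
  proof -
    obtain a where a: "a < length vs" "vs ! a = x"
      using x vs(2) by (metis in_set_conv_nth)
    show ?thesis
      using row_sum_dist_mat[OF vs a(1), of i] row_sum_poly_mat[OF A _ a(1), of "real d" p]
        row_sum_dist_mat_1[OF reg vs] a(2) unfolding p by simp
  qed
  with u v show ?thesis by (metis of_nat_eq_iff)
qed

end

section \<open>Regular graphs of diameter at most two\<close>

text \<open>
  Regular graphs of diameter at most two. Each such graph is in the classes DDR, CDDR and DP, because the
  sphere of radius two is the complement of the closed neighbourhood; for DMR one more number has to be
  constant, the number of triangles at a vertex.
\<close>

locale regular_diam_le_2 = pair_graph G for G :: "'a pair_pre_digraph" +
  fixes d :: nat
  assumes nonempty: "pverts G \<noteq> {}"
    and regular: "u \<in> pverts G \<Longrightarrow> card (parcs G `` {u}) = d"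
    and diam_le_2: "u \<in> pverts G \<Longrightarrow>
      pverts G \<subseteq> insert u (parcs G `` {u} \<union> parcs G `` (parcs G `` {u}))"
begin

lemma not_self_neighbour: "u \<notin> parcs G `` {u}"
  using pair_no_loops by fastforce

lemma neighbours_subset: "parcs G `` {u} \<subseteq> pverts G"
  by (auto dest: in_arcsD2)

lemma finite_neighbours: "finite (parcs G `` {u})"
  using neighbours_subset finite_subset pair_finite_verts by blast

lemma sphere_2_eq:
  assumes u: "u \<in> pverts G"
  shows "sphere_at G 2 u = pverts G - insert u (parcs G `` {u})"
  unfolding sphere_2[OF u] using diam_le_2[OF u] by (auto dest: in_arcsD2)

lemma verts_eq_spheres:
  assumes u: "u \<in> pverts G"
  shows "pverts G = sphere_at G 0 u \<union> sphere_at G 1 u \<union> sphere_at G 2 u"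
  unfolding sphere_0[OF u] sphere_1[OF u] sphere_2_eq[OF u] using u neighbours_subset by blast

lemma sphere_empty:
  assumes u: "u \<in> pverts G" and "2 < i"
  shows "sphere_at G i u = {}"
proof -
  have "sphere_at G i u \<subseteq> sphere_at G 0 u \<union> sphere_at G 1 u \<union> sphere_at G 2 u"
    unfolding verts_eq_spheres[OF u, symmetric] by (rule sphere_subset)
  moreover have "sphere_at G i u \<inter> sphere_at G j u = {}" if "j \<in> {0, 1, 2}" for j
    using that \<open>2 < i\<close> by (intro sphere_disjoint) auto
  ultimately show ?thesis by blast
qed

lemma diam_le: "diam G \<le> 2"
proof -
  have "{i. \<exists>u\<in>pverts G. sphere_at G i u \<noteq> {}} \<noteq> {}"
    using nonempty sphere_0 by blast
  then show ?thesis
    unfolding diam_def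
    by (subst Max_le_iff[OF finite_nonempty_radii]) (use sphere_empty not_le in blast)+
qed

lemma card_sphere_eq:
  assumes u: "u \<in> pverts G" and v: "v \<in> pverts G"
  shows "card (sphere_at G i u) = card (sphere_at G i v)"
proof -
  consider "i = 0" | "i = 1" | "i = 2" | "2 < i" by linarith
  then show ?thesis
  proof cases
    case 3
    have "card (sphere_at G 2 x) = card (pverts G) - Suc d" if "x \<in> pverts G" for x
      using that not_self_neighbour[of x] neighbours_subset[of x]
      by (simp add: sphere_2_eq card_Diff_subset finite_neighbours regular)
    then show ?thesis using 3 u v by simp
  qed (use u v in \<open>simp_all add: sphere_0 sphere_1[simplified] regular sphere_empty\<close>)
qed

lemma DDR: "DDR G"
  unfolding DDR_def using card_sphere_eq by blast

text \<open>
  Only radii 1 and 2 occur. Equal radii are trivial, and for different radii the intersection consists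
  of the neighbours of one vertex outside the closed neighbourhood of the other, whose number is
  symmetric in the two vertices.
\<close>

lemma CDDR: "CDDR G"
proof -
  have mixed: "card (sphere_at G 1 u \<inter> sphere_at G 2 v)
      = d - (card (parcs G `` {u} \<inter> parcs G `` {v}) + (if (u, v) \<in> parcs G then 1 else 0))"
    if u: "u \<in> pverts G" and v: "v \<in> pverts G" for u v
  proof -
    have "sphere_at G 1 u \<inter> sphere_at G 2 v
        = parcs G `` {u} - insert v (parcs G `` {v})"
      unfolding sphere_1[OF u] sphere_2_eq[OF v] using neighbours_subset by blast
    then show ?thesis
      using not_self_neighbour[of v]
      by (simp add: card_Diff_subset_Int finite_neighbours regular[OF u] Int_insert_right)
  qed
  show ?thesis
    unfolding CDDR_def
  proof (intro ballI)
    fix u v i j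
    assume u: "u \<in> pverts G" and v: "v \<in> pverts G" and "i \<in> {1..diam G}" "j \<in> {1..diam G}"
    then have "i = 1 \<or> i = 2" "j = 1 \<or> j = 2" using diam_le by auto
    then show "card (sphere_at G i u \<inter> sphere_at G j v) = card (sphere_at G i v \<inter> sphere_at G j u)"
      using mixed[OF u v] mixed[OF v u] parcs_sym[of u v]
      by (elim disjE) (simp_all add: Int_commute)
  qed
qed

lemma card_eq_sum_sphere_intersections:
  assumes u: "u \<in> pverts G" and X: "X \<subseteq> pverts G"
  shows "card X = card (X \<inter> sphere_at G 0 u) + card (X \<inter> sphere_at G 1 u) + card (X \<inter> sphere_at G 2 u)"
proof -
  have "X = (X \<inter> sphere_at G 0 u) \<union> (X \<inter> sphere_at G 1 u) \<union> (X \<inter> sphere_at G 2 u)"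
    using verts_eq_spheres[OF u] X by blast
  also have "card \<dots> = card ((X \<inter> sphere_at G 0 u) \<union> (X \<inter> sphere_at G 1 u)) + card (X \<inter> sphere_at G 2 u)"
    using sphere_disjoint[of 0 2 u] sphere_disjoint[of 1 2 u]
    by (intro card_Un_disjoint finite_UnI finite_Int disjI2 finite_sphere) auto
  also have "card ((X \<inter> sphere_at G 0 u) \<union> (X \<inter> sphere_at G 1 u))
      = card (X \<inter> sphere_at G 0 u) + card (X \<inter> sphere_at G 1 u)"
    using sphere_disjoint[of 0 1 u]
    by (intro card_Un_disjoint finite_Int disjI2 finite_sphere) auto
  finally show ?thesis .
qed

text \<open>
  Let \<open>S h i j u\<close> count the pairs \<open>(v, w)\<close> with \<open>v\<close> at distance \<open>h\<close> and \<open>w\<close> at distance \<open>i\<close> from \<open>u\<close>, and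
  \<open>v\<close>, \<open>w\<close> at distance \<open>j\<close>. Means are constant once all \<open>S h i j\<close> are. If one of \<open>h\<close>, \<open>i\<close>, \<open>j\<close> is zero, the
  count is a sphere size or zero. Counts are symmetric in \<open>h\<close> and \<open>i\<close>, and summing over \<open>i\<close> or over \<open>j\<close>
  gives products of sphere sizes. With only the radii 0, 1, 2 available, these linear relations express
  everything through \<open>S 1 1 1\<close>, which is the assumed number \<open>t\<close>, that is, twice the number of triangles
  at \<open>u\<close>.
\<close>

lemma DMR_if_triangles_constant:
  assumes triangles: "\<And>u. u \<in> pverts G \<Longrightarrow>
    (\<Sum>v\<in>parcs G `` {u}. card (parcs G `` {u} \<inter> parcs G `` {v})) = t"
  shows "DMR G"
proof -
  define S where "S h i j u = (\<Sum>v\<in>sphere_at G h u. card (sphere_at G i u \<inter> sphere_at G j v))"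
    for h i j u
  obtain u0 where "u0 \<in> pverts G" using nonempty by blast
  define c where "c i = card (sphere_at G i u0)" for i
  have c: "card (sphere_at G i u) = c i" if "u \<in> pverts G" for u i
    unfolding c_def using card_sphere_eq that \<open>u0 \<in> pverts G\<close> by blast
  have S_swap: "S h i j u = S i h j u" if "u \<in> pverts G" for h i j u
    unfolding S_def by (rule sum_sphere_intersections_swap[OF that])
  have S_0: "S 0 i j u = (if i = j then c i else 0)" if u: "u \<in> pverts G" for i j u
    using sphere_disjoint[of i j u] by (simp add: S_def sphere_0[OF u] c[OF u])
  have S_h_i_0: "S h i 0 u = (if h = i then c h else 0)" if u: "u \<in> pverts G" for h i u
  proof -
    have "S h i 0 u = (\<Sum>v\<in>sphere_at G h u. if h = i then 1 else 0)"
      unfolding S_def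
    proof (intro sum.cong refl)
      fix v assume v: "v \<in> sphere_at G h u"
      then have "sphere_at G 0 v = {v}" using sphere_subset sphere_0 by blast
      then show "card (sphere_at G i u \<inter> sphere_at G 0 v) = (if h = i then 1 else 0)"
        using v sphere_disjoint[of h i u] by auto
    qed
    then show ?thesis by (simp add: c[OF u])
  qed
  have S_sum_second: "S h 0 j u + S h 1 j u + S h 2 j u = c h * c j" if u: "u \<in> pverts G" for h j u
  proof -
    have "S h 0 j u + S h 1 j u + S h 2 j u = (\<Sum>v\<in>sphere_at G h u. card (sphere_at G j v))"
      unfolding S_def sum.distrib[symmetric]
      using card_eq_sum_sphere_intersections[OF u sphere_subset[of j], symmetric]
      by (intro sum.cong refl) (simp only: Int_commute)
    also have "\<dots> = (\<Sum>v\<in>sphere_at G h u. c j)"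
      using sphere_subset c by (intro sum.cong refl) blast
    finally show ?thesis by (simp add: c[OF u])
  qed
  have S_sum_third: "S h i 0 u + S h i 1 u + S h i 2 u = c h * c i" if u: "u \<in> pverts G" for h i u
  proof -
    have "S h i 0 u + S h i 1 u + S h i 2 u = (\<Sum>v\<in>sphere_at G h u. card (sphere_at G i u))"
      unfolding S_def sum.distrib[symmetric]
      using card_eq_sum_sphere_intersections[OF _ sphere_subset[of i u]] sphere_subset[of h u]
      by (intro sum.cong refl) auto
    then show ?thesis by (simp add: c[OF u])
  qed
  have S_111: "S 1 1 1 u = t" if u: "u \<in> pverts G" for u
  proof -
    have "S 1 1 1 u = (\<Sum>v\<in>parcs G `` {u}. card (parcs G `` {u} \<inter> parcs G `` {v}))"
      unfolding S_def sphere_1[OF u] using sphere_1 neighbours_subset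
      by (intro sum.cong refl arg_cong[of _ _ card]) blast
    then show ?thesis using triangles[OF u] by simp
  qed
  have S_1: "S h i 1 u = S h i 1 v"
    if u: "u \<in> pverts G" and v: "v \<in> pverts G" and hi: "h \<le> 2" "i \<le> 2" for h i u v
  proof -
    \<comment> \<open>The relations for \<open>j = 1\<close> involve no other third index: with \<open>S 1 1 1\<close> they give \<open>S 1 2 1\<close>,
      then \<open>S 2 1 1\<close> by symmetry, then \<open>S 2 2 1\<close>.\<close>
    have vals: "S 1 2 1 x = c 1 * c 1 - c 1 - t" "S 2 1 1 x = c 1 * c 1 - c 1 - t"
      "S 2 2 1 x = c 2 * c 1 - (c 1 * c 1 - c 1 - t)" if x: "x \<in> pverts G" for x
    proof -
      have "c 1 + t + S 1 2 1 x = c 1 * c 1"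
        using S_sum_second[OF x, of 1 1] S_swap[OF x, of 1 0 1] S_0[OF x, of 1 1] S_111[OF x]
        by simp
      then show "S 1 2 1 x = c 1 * c 1 - c 1 - t" by linarith
      then show *: "S 2 1 1 x = c 1 * c 1 - c 1 - t" using S_swap[OF x, of 2 1 1] by simp
      show "S 2 2 1 x = c 2 * c 1 - (c 1 * c 1 - c 1 - t)"
        using S_sum_second[OF x, of 2 1] S_swap[OF x, of 2 0 1] S_0[OF x, of 2 1] *
        by simp
    qed
    have "h = 0 \<or> h = 1 \<or> h = 2" "i = 0 \<or> i = 1 \<or> i = 2" using hi by auto
    then show ?thesis
      using vals[OF u] vals[OF v] S_111[OF u] S_111[OF v] S_0[OF u, of _ 1] S_0[OF v, of _ 1]
        S_swap[OF u, of _ 0 1] S_swap[OF v, of _ 0 1]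
      by (elim disjE) simp_all
  qed
  have S_const: "S h i j u = S h i j v"
    if u: "u \<in> pverts G" and v: "v \<in> pverts G" and hij: "h \<le> 2" "i \<le> 2" "j \<le> 2" for h i j u v
  proof -
    have "j = 0 \<or> j = 1 \<or> j = 2" using hij by auto
    then show ?thesis
      using S_h_i_0[OF u, of h i] S_h_i_0[OF v, of h i] S_1[OF u v hij(1,2)]
        S_sum_third[OF u, of h i] S_sum_third[OF v, of h i]
      by (elim disjE) simp_all
  qed
  have mean: "mean_intersection G h i j u = real (S h i j u) / real (c h)" if "u \<in> pverts G" for h i j u
    using c[OF that] by (simp add: mean_intersection_def S_def)
  show ?thesis
    unfolding DMR_def
  proof (intro ballI)
    fix h i j u v
    assume "h \<in> {0..diam G}" "i \<in> {0..diam G}" "j \<in> {0..diam G}"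
      and u: "u \<in> pverts G" and v: "v \<in> pverts G"
    then have "S h i j u = S h i j v"
      using diam_le by (intro S_const) auto
    then show "mean_intersection G h i j u = mean_intersection G h i j v"
      using mean u v by simp
  qed
qed

lemma connected: "Digraph_Component.connected (with_proj G)"
proof (rule connectedI)
  fix u v
  assume uv: "u \<in> pverts G" "v \<in> pverts G"
  then obtain n where "v \<in> sphere_at G n u"
    using verts_eq_spheres[of u] by blast
  then have "\<exists>p. awalk u p v"
    using awalk_of_length_iff[of u v n] uv by (auto simp: in_sphere_iff)
  then show "u \<rightarrow>\<^sup>*\<^bsub>with_proj (mk_symmetric (with_proj G))\<^esub> v"
    by (simp add: reachable_mk_symmetric_eq[OF pair_sym_arcs] reachable_awalk)
qed (use nonempty in simp)

text \<open>
  By regularity and connectedness the all-ones matrix \<open>J\<close> is a polynomial in the adjacency matrix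
  \<open>A\<close>, and the only other distance matrix is \<open>J - I - A\<close>.
\<close>

lemma DP: "DP G"
proof -
  obtain vs where vs: "distinct vs" "set vs = pverts G"
    using finite_distinct_list[OF pair_finite_verts] by blast
  define n where "n = length vs"
  define A where "A = dist_mat G vs 1"
  have A: "A \<in> carrier_mat n n"
    by (simp add: A_def n_def dist_mat_def)
  have "0 < n" using vs nonempty by (auto simp: n_def)
  have mem: "vs ! i \<in> pverts G" if "i < n" for i
    using that vs(2) n_def nth_mem by blast
  have entry: "A $$ (i, j) = (if (vs ! i, vs ! j) \<in> parcs G then 1 else 0)" if "i < n" "j < n" for i j
    using dist_mat_1_index[OF vs(2)] that by (simp add: A_def n_def)
  have rows: "(\<Sum>j<n. A $$ (i, j)) = real d" if "i < n" for i
    using row_sum_dist_mat_1[OF regular vs] that by (simp add: A_def n_def)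
  have sym: "A $$ (i, j) = A $$ (j, i)" if "i < n" "j < n" for i j
    using that parcs_sym[of "vs ! i" "vs ! j"] by (simp add: entry)
  have simple: "x i = x j"
    if eigen: "\<And>k. k < n \<Longrightarrow> (\<Sum>l<n. x l * A $$ (l, k)) = real d * x k" and ij: "i < n" "j < n"
    for x i j
  proof -
    \<comment> \<open>Maximum principle: where an eigenvector for the degree attains its maximum, all neighbours
      attain it too, and two steps reach every vertex.\<close>
    define M where "M = Max (x ` {..<n})"
    have le: "x l \<le> M" if "l < n" for l
      using that by (auto simp: M_def)
    have spread: "x l = M" if k: "k < n" and xk: "x k = M" and l: "l < n" and arc: "(vs ! k, vs ! l) \<in> parcs G"
      for k l
    proof -
      have "(\<Sum>l<n. (M - x l) * A $$ (l, k)) = M * (\<Sum>l<n. A $$ (l, k)) - (\<Sum>l<n. x l * A $$ (l, k))"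
        by (simp add: left_diff_distrib sum_subtractf sum_distrib_left)
      also have "(\<Sum>l<n. A $$ (l, k)) = real d"
        using rows[OF k] sym k by simp
      finally have "(\<Sum>l<n. (M - x l) * A $$ (l, k)) = 0"
        using eigen[OF k] xk by simp
      moreover have "0 \<le> (M - x l) * A $$ (l, k)" if "l < n" for l
        using le[OF that] that k by (simp add: entry)
      ultimately have "(M - x l) * A $$ (l, k) = 0"
        using l sum_nonneg_eq_0_iff[of "{..<n}" "\<lambda>l. (M - x l) * A $$ (l, k)"] by auto
      then show ?thesis
        using arc entry[OF l k] parcs_sym[of "vs ! k" "vs ! l"] by simp
    qed
    have "M \<in> x ` {..<n}"
      unfolding M_def using \<open>0 < n\<close> by (intro Max_in) auto
    then obtain k where k: "k < n" "x k = M" by auto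
    have "x l = M" if l: "l < n" for l
    proof -
      consider "vs ! l = vs ! k" | "(vs ! k, vs ! l) \<in> parcs G"
        | w where "(vs ! k, w) \<in> parcs G" "(w, vs ! l) \<in> parcs G"
        using diam_le_2[OF mem[OF k(1)]] mem[OF l] by blast
      then show ?thesis
      proof cases
        case 1
        then show ?thesis using vs(1) k l by (simp add: n_def nth_eq_iff_index_eq)
      next
        case 2
        then show ?thesis using spread k l by blast
      next
        case 3
        then obtain b where "b < n" "vs ! b = w"
          by (metis in_arcsD2 in_set_conv_nth n_def vs(2))
        with 3 show ?thesis using spread[OF k] spread[of b l] l by blast
      qed
    qed
    then show ?thesis using ij by simp
  qed
  obtain p where p: "\<And>i j. i < n \<Longrightarrow> j < n \<Longrightarrow> poly_mat p A $$ (i, j) = 1"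
    using all_ones_poly_mat[OF A \<open>0 < n\<close> rows simple] by blast
  have X: "poly_mat [:0, 1:] A $$ (i, j) = A $$ (i, j)" if "i < n" "j < n" for i j
    using A that by (simp add: poly_mat_index[OF A that, of _ 1])
  have one: "poly_mat 1 A $$ (i, j) = (if i = j then 1 else 0)" if "i < n" "j < n" for i j
    using A that by (simp add: poly_mat_index[OF A that, of _ 0])
  have A1: "dist_mat G vs 1 = poly_mat [:0, 1:] A"
    using A X by (intro eq_matI) (auto simp: poly_mat_def A_def)
  have A2: "dist_mat G vs 2 = poly_mat (p + Polynomial.smult (- 1) (1 + [:0, 1:])) A"
  proof (rule eq_matI)
    fix i j
    assume "i < dim_row (poly_mat (p + Polynomial.smult (- 1) (1 + [:0, 1:])) A)"
      and "j < dim_col (poly_mat (p + Polynomial.smult (- 1) (1 + [:0, 1:])) A)"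
    then have ij: "i < n" "j < n" using A by (auto simp: poly_mat_def)
    have "gdist G (vs ! i) (vs ! j) = ereal (real 2) \<longleftrightarrow> vs ! j \<in> sphere_at G 2 (vs ! i)"
      using mem[OF ij(2)] by (simp add: sphere_at_def)
    also have "\<dots> \<longleftrightarrow> i \<noteq> j \<and> (vs ! i, vs ! j) \<notin> parcs G"
      using ij mem vs(1) by (auto simp: sphere_2_eq n_def nth_eq_iff_index_eq)
    finally have "dist_mat G vs 2 $$ (i, j) = (if i \<noteq> j \<and> (vs ! i, vs ! j) \<notin> parcs G then 1 else 0)"
      using ij by (simp add: dist_mat_def n_def)
    also have "\<dots> = 1 - ((if i = j then 1 else 0) + A $$ (i, j))"
      using pair_no_loops[of "(vs ! i, vs ! i)"] by (auto simp: entry[OF ij])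
    also have "\<dots> = poly_mat (p + Polynomial.smult (- 1) (1 + [:0, 1:])) A $$ (i, j)"
      unfolding poly_mat_index_add[OF A ij] poly_mat_index_smult[OF A ij] p[OF ij] X[OF ij] one[OF ij]
      by simp
    finally show "dist_mat G vs 2 $$ (i, j)
        = poly_mat (p + Polynomial.smult (- 1) (1 + [:0, 1:])) A $$ (i, j)" .
  qed (use A in \<open>auto simp: poly_mat_def dist_mat_def n_def\<close>)
  have "i = 1 \<or> i = 2" if "i \<in> {1..diam G}" for i
    using that diam_le by auto
  then have "\<forall>i\<in>{1..diam G}. \<exists>q. dist_mat G vs i = poly_mat q (dist_mat G vs 1)"
    using A1 A2 unfolding A_def by blast
  then show ?thesis using vs unfolding DP_def by blast
qed

end

section \<open>The bipartite double cover\<close>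

definition complete_graph_2 :: "nat pair_pre_digraph" where
  "complete_graph_2 = \<lparr> pverts = {0, 1}, parcs = {(0, 1), (1, 0)} \<rparr>"

lemma regular_diam_le_2_complete_graph_2: "regular_diam_le_2 complete_graph_2 1"
proof unfold_locales
  show "card (parcs complete_graph_2 `` {u}) = 1" if "u \<in> pverts complete_graph_2" for u
  proof -
    have "parcs complete_graph_2 `` {u} = {1 - u}"
      using that by (auto simp: complete_graph_2_def)
    then show ?thesis by simp
  qed
qed (auto simp: complete_graph_2_def symmetric_def sym_def)

lemma arc_double_iff:
  "((g, b), (g', b')) \<in> parcs (direct_product G complete_graph_2)
    \<longleftrightarrow> (g, g') \<in> parcs G \<and> b \<in> {0, 1} \<and> b' = 1 - b"
  by (auto simp: direct_product_def complete_graph_2_def)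

lemma neighbours_double:
  fixes G :: "'a pair_pre_digraph"
  assumes "b \<in> {0, 1}"
  shows "parcs (direct_product G complete_graph_2) `` (X \<times> {b}) = (parcs G `` X) \<times> {1 - b}"
proof (rule Set.set_eqI)
  fix p
  fix p :: "'a \<times> nat"
  obtain g b' where "p = (g, b')" by (cases p)
  then show "p \<in> parcs (direct_product G complete_graph_2) `` (X \<times> {b})
      \<longleftrightarrow> p \<in> (parcs G `` X) \<times> {1 - b}"
    using assms by (simp only: Image_iff) (auto simp: arc_double_iff)
qed

text \<open>
  The product with the single edge is the bipartite double cover, where walks returning to the same
  side are the walks of even length. Hence a neighbour \<open>v\<close> of \<open>u\<close> is found at distance two from \<open>u\<close>, on
  the side of \<open>u\<close>, precisely if the edge \<open>u v\<close> lies in a triangle.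
\<close>

lemma sphere_2_double:
  assumes G: "pair_graph G" and u: "u \<in> pverts G"
  shows "sphere_at (direct_product G complete_graph_2) 2 (u, 0)
    = (parcs G `` (parcs G `` {u}) - {u}) \<times> {0}"
proof -
  interpret P: pair_graph "direct_product G complete_graph_2"
    using pair_graph_direct_product[OF G regular_diam_le_2.axioms(1)] regular_diam_le_2_complete_graph_2
    by blast
  have "(u, 0) \<in> pverts (direct_product G complete_graph_2)"
    using u by (simp add: direct_product_def complete_graph_2_def)
  then have "sphere_at (direct_product G complete_graph_2) 2 (u, 0)
      = (parcs G `` (parcs G `` {u})) \<times> {0} - insert (u, 0) ((parcs G `` {u}) \<times> {1})"
    using neighbours_double[of 0 G "{u}"] neighbours_double[of 1 G "parcs G `` {u}"]
    by (simp add: P.sphere_2)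
  then show ?thesis by auto
qed

text \<open>
  Each of the four properties forces spheres of radius two around \<open>(u, 0)\<close> and \<open>(v, 0)\<close> to have equal
  size: for DP since the product is again regular, and for CDDR since a common neighbour of \<open>u\<close> and \<open>v\<close>
  puts the two centres into one component.
\<close>

lemma double_not_in_classes:
  assumes G: "pair_graph G" and reg: "\<And>x. x \<in> pverts G \<Longrightarrow> card (parcs G `` {x}) = d"
    and uv: "u \<in> pverts G" "v \<in> pverts G" and common: "parcs G `` {u} \<inter> parcs G `` {v} \<noteq> {}"
    and diff: "card (parcs G `` (parcs G `` {u}) - {u}) \<noteq> card (parcs G `` (parcs G `` {v}) - {v})"
  defines "P \<equiv> direct_product G complete_graph_2"
  shows "\<not> DDR P" and "\<not> CDDR P" and "\<not> DMR P" and "\<not> DP P"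
proof -
  interpret G: pair_graph G by (rule G)
  interpret P: pair_graph P
    unfolding P_def
    using pair_graph_direct_product[OF G regular_diam_le_2.axioms(1)] regular_diam_le_2_complete_graph_2
    by blast
  have verts: "(u, 0) \<in> pverts P" "(v, 0) \<in> pverts P"
    using uv by (auto simp: P_def direct_product_def complete_graph_2_def)
  have ne: "card (sphere_at P 2 (u, 0)) \<noteq> card (sphere_at P 2 (v, 0))"
    using diff by (simp add: P_def sphere_2_double[OF G] uv card_cartesian_product_singleton
        card_cartesian_product)
  then have "sphere_at P 2 (u, 0) \<noteq> {} \<or> sphere_at P 2 (v, 0) \<noteq> {}"
    by auto
  then have diam: "2 \<le> diam P"
    using P.le_diam verts by blast
  show "\<not> DDR P"
    using ne verts unfolding DDR_def by blast
  show "\<not> DMR P"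
    using P.DMR_imp_card_sphere_eq[OF _ verts diam] ne by blast
  obtain w where "(u, w) \<in> parcs G" "(w, v) \<in> parcs G"
    using common G.parcs_sym by blast
  then have "((u, 0), (v, 0)) \<in> parcs P O parcs P"
    by (intro relcompI[of _ "(w, 1)"]) (auto simp: P_def direct_product_def complete_graph_2_def)
  then have "((u, 0), (v, 0)) \<in> parcs P ^^ 2"
    by (simp add: numeral_2_eq_2)
  then show "\<not> CDDR P"
    using P.CDDR_imp_card_sphere_eq[OF _ verts _, of 2 2] diam ne by auto
  have "card (parcs P `` {x}) = d" if "x \<in> pverts P" for x
  proof -
    obtain a b where "x = (a, b)" by (cases x)
    with that have x: "x = (a, b)" "a \<in> pverts G" "b \<in> {0, 1}"
      by (auto simp: P_def direct_product_def complete_graph_2_def)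
    have "parcs P `` ({a} \<times> {b}) = parcs G `` {a} \<times> {1 - b}"
      unfolding P_def by (rule neighbours_double[OF x(3)])
    then show ?thesis
      using x reg by (simp add: card_cartesian_product)
  qed
  then show "\<not> DP P"
    using P.DP_imp_card_sphere_eq[OF _ _ verts, of d 2] diam ne by auto
qed

section \<open>A graph on nine vertices\<close>

text \<open>
  A diamond is a complete graph on four vertices with one edge removed. Take two copies, on 0, 1, 2, 3
  and on 4, 5, 6, 7, with the edges 2-3 and 6-7 missing; join corresponding vertices by rungs, and join
  a further vertex 8 to the four vertices of degree three. The rungs 0-4 and 1-5 are the only edges in
  no triangle, yet every vertex is in two triangles: at 0, 1, 4, 5 the two share an edge, elsewhere
  they do not.
\<close>

definition diamond_prism_cone :: "nat pair_pre_digraph" where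
  "diamond_prism_cone = (let E = {(0, 1), (0, 2), (0, 3), (1, 2), (1, 3),
      (4, 5), (4, 6), (4, 7), (5, 6), (5, 7),
      (0, 4), (1, 5), (2, 6), (3, 7),
      (2, 8), (3, 8), (6, 8), (7, 8)}
    in \<lparr> pverts = {..8}, parcs = E \<union> E\<inverse> \<rparr>)"

lemma pverts_diamond_prism_cone: "pverts diamond_prism_cone = {0, 1, 2, 3, 4, 5, 6, 7, 8}"
  by (auto simp: diamond_prism_cone_def)

lemma Image_insert_arc:
  "insert (a, b) R `` {x} = (if x = a then insert b (R `` {x}) else R `` {x})"
  "(insert (a, b) R)\<inverse> = insert (b, a) (R\<inverse>)"
  by auto

lemma neighbours_diamond_prism_cone:
  "parcs diamond_prism_cone `` {0} = {1, 2, 3, 4}"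
  "parcs diamond_prism_cone `` {1} = {0, 2, 3, 5}"
  "parcs diamond_prism_cone `` {2} = {0, 1, 6, 8}"
  "parcs diamond_prism_cone `` {3} = {0, 1, 7, 8}"
  "parcs diamond_prism_cone `` {4} = {0, 5, 6, 7}"
  "parcs diamond_prism_cone `` {5} = {1, 4, 6, 7}"
  "parcs diamond_prism_cone `` {6} = {2, 4, 5, 8}"
  "parcs diamond_prism_cone `` {7} = {3, 4, 5, 8}"
  "parcs diamond_prism_cone `` {8} = {2, 3, 6, 7}"
  unfolding diamond_prism_cone_def Let_def pair_pre_digraph.simps Un_Image
  by (simp_all add: Image_insert_arc) auto

text \<open>
  The pattern with two elements keeps the rule from applying to its own right-hand side.
\<close>

lemma Image_insert_Un: "R `` insert a (insert b X) = R `` {a} \<union> R `` insert b X"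
  by auto

lemma pair_graph_diamond_prism_cone: "pair_graph diamond_prism_cone"
  by unfold_locales (auto simp: diamond_prism_cone_def symmetric_def sym_def)

lemma regular_diam_le_2_diamond_prism_cone: "regular_diam_le_2 diamond_prism_cone 4"
proof -
  interpret pair_graph diamond_prism_cone by (rule pair_graph_diamond_prism_cone)
  show ?thesis
  proof unfold_locales
    fix u
    assume "u \<in> pverts diamond_prism_cone"
    then consider "u = 0" | "u = 1" | "u = 2" | "u = 3" | "u = 4" | "u = 5" | "u = 6" | "u = 7" | "u = 8"
      by (auto simp: pverts_diamond_prism_cone)
    then show "card (parcs diamond_prism_cone `` {u}) = 4"
      and "pverts diamond_prism_cone \<subseteq> insert u (parcs diamond_prism_cone `` {u} \<union>
        parcs diamond_prism_cone `` (parcs diamond_prism_cone `` {u}))"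
      by (cases; simp add: neighbours_diamond_prism_cone[simplified]
          pverts_diamond_prism_cone Image_insert_Un)+
  qed (simp add: pverts_diamond_prism_cone)
qed

text \<open>
  The sum counts each triangle at \<open>u\<close> twice, once for each of its two other vertices.
\<close>

lemma triangles_diamond_prism_cone:
  assumes "u \<in> pverts diamond_prism_cone"
  shows "(\<Sum>v\<in>parcs diamond_prism_cone `` {u}.
    card (parcs diamond_prism_cone `` {u} \<inter> parcs diamond_prism_cone `` {v})) = 4"
proof -
  consider "u = 0" | "u = 1" | "u = 2" | "u = 3" | "u = 4" | "u = 5" | "u = 6" | "u = 7" | "u = 8"
    using assms by (auto simp: pverts_diamond_prism_cone)
  then show ?thesis
    by cases (simp_all add: neighbours_diamond_prism_cone[simplified])
qed

text \<open>
  Vertex 4 is missing in the first set because the edge 0-4 is in no triangle.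
\<close>

lemma two_step_neighbours_diamond_prism_cone:
  "parcs diamond_prism_cone `` (parcs diamond_prism_cone `` {0}) - {0} = {1, 2, 3, 5, 6, 7, 8}"
  "parcs diamond_prism_cone `` (parcs diamond_prism_cone `` {2}) - {2} = {0, 1, 3, 4, 5, 6, 7, 8}"
  by (auto simp: neighbours_diamond_prism_cone[simplified] Image_insert_Un)

theorem theorem5p1:
  shows
    "(\<exists>(G :: nat pair_pre_digraph) (H :: nat pair_pre_digraph).
        pair_graph G \<and> Digraph_Component.connected (with_proj G) \<and> DDR G \<and>
        pair_graph H \<and> Digraph_Component.connected (with_proj H) \<and> DDR H \<and>
        \<not> DDR (direct_product G H)) \<and>
     (\<exists>(G :: nat pair_pre_digraph) (H :: nat pair_pre_digraph).
        pair_graph G \<and> Digraph_Component.connected (with_proj G) \<and> CDDR G \<and>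
        pair_graph H \<and> Digraph_Component.connected (with_proj H) \<and> CDDR H \<and>
        \<not> CDDR (direct_product G H)) \<and>
     (\<exists>(G :: nat pair_pre_digraph) (H :: nat pair_pre_digraph).
        pair_graph G \<and> Digraph_Component.connected (with_proj G) \<and> DMR G \<and>
        pair_graph H \<and> Digraph_Component.connected (with_proj H) \<and> DMR H \<and>
        \<not> DMR (direct_product G H)) \<and>
     (\<exists>(G :: nat pair_pre_digraph) (H :: nat pair_pre_digraph).
        pair_graph G \<and> Digraph_Component.connected (with_proj G) \<and> DP G \<and>
        pair_graph H \<and> Digraph_Component.connected (with_proj H) \<and> DP H \<and>
        \<not> DP (direct_product G H))"
proof -
  interpret G: regular_diam_le_2 diamond_prism_cone 4
    by (rule regular_diam_le_2_diamond_prism_cone)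
  interpret H: regular_diam_le_2 complete_graph_2 1
    by (rule regular_diam_le_2_complete_graph_2)
  have "DMR complete_graph_2"
  proof (rule H.DMR_if_triangles_constant)
    show "(\<Sum>v\<in>parcs complete_graph_2 `` {u}.
        card (parcs complete_graph_2 `` {u} \<inter> parcs complete_graph_2 `` {v})) = 0"
      if "u \<in> pverts complete_graph_2" for u
      by (auto simp: complete_graph_2_def)
  qed
  have "1 \<in> parcs diamond_prism_cone `` {0} \<inter> parcs diamond_prism_cone `` {2}"
    unfolding neighbours_diamond_prism_cone by simp
  then have common: "parcs diamond_prism_cone `` {0} \<inter> parcs diamond_prism_cone `` {2} \<noteq> {}"
    by blast
  have "card (parcs diamond_prism_cone `` (parcs diamond_prism_cone `` {0}) - {0})
      \<noteq> card (parcs diamond_prism_cone `` (parcs diamond_prism_cone `` {2}) - {2})"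
    unfolding two_step_neighbours_diamond_prism_cone by simp
  note product = double_not_in_classes[OF pair_graph_diamond_prism_cone G.regular _ _ common this]
  have mem: "0 \<in> pverts diamond_prism_cone" "2 \<in> pverts diamond_prism_cone"
    by (simp_all add: pverts_diamond_prism_cone)
  show ?thesis
    using pair_graph_diamond_prism_cone H.pair_graph_axioms G.connected H.connected
      G.DDR H.DDR G.CDDR H.CDDR G.DMR_if_triangles_constant[OF triangles_diamond_prism_cone] \<open>DMR complete_graph_2\<close>
      G.DP H.DP product[OF _ mem]
    by blast
qed

end
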